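(* Let $D\subseteq\mathbb{N}_{\ge2}$ be a nonempty finite subset with no two (distinct) elements being powers of the same integer. Suppose that $D=D_1\cup D_2\cup C$ is a partition of $D$ into nonempty subsets such that $\gcd(C)=1$ and $$\sum_{d\in D_i}\frac{1}{d-1}\ge1$$ for every $i=1,2$. Then $$\mathcal{P}(D):=\bigcup_{d\in D}\{d^n:n\in\mathbb{N}\}$$ is strongly complete.
   Context: $\mathbb{N}=\{1,2,3,\ldots\}$ and $\mathbb{N}_{\ge2}=\{2,3,\ldots\}$. $\gcd(C)$ is the greatest common divisor of all elements of $C$. A set $A\subseteq\mathbb{N}$ is complete if every sufficiently large positive integer is a sum of distinct elements of $A$, and strongly complete if $A\setminus B$ is complete for every finite subset $B\subseteq A$. *)

theory Defs
  imports Complex_Main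
begin

text \<open>The paper's sets of positive integers are rendered as sets of type \<^typ>\<open>nat set\<close>;
  membership of 0 would not affect the two notions of completeness.\<close>

definition complete_set :: "nat set \<Rightarrow> bool" where
  "complete_set A \<longleftrightarrow> (\<forall>\<^sub>F n in sequentially. \<exists>S. finite S \<and> S \<subseteq> A \<and> n = \<Sum>S)"

definition strongly_complete_set :: "nat set \<Rightarrow> bool" where
  "strongly_complete_set A \<longleftrightarrow> (\<forall>B. finite B \<and> B \<subseteq> A \<longrightarrow> complete_set (A - B))"

definition pos_powers :: "nat set \<Rightarrow> nat set" where
  "pos_powers D = (\<Union>d\<in>D. {d ^ n | n. n \<ge> 1})"

text \<open>A zero exponent yields 1, so for numbers at least 2 it makes no difference that the
  exponents below range over all natural numbers.\<close>

definition powers_of_same_integer :: "nat \<Rightarrow> nat \<Rightarrow> bool" where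
  "powers_of_same_integer a b \<longleftrightarrow> (\<exists>(c::int) i j. int a = c ^ i \<and> int b = c ^ j)"

end

theory Submission
  imports Defs "HOL-Library.Set_Algebras" "HOL-Number_Theory.Cong"
    "HOL-Computational_Algebra.Nth_Powers"
begin

text \<open>
  Fix a finite set to be removed and work only with the powers \<open>d ^ n\<close> for \<open>n \<ge> k\<close>, where \<open>k\<close>
  is so large that they all avoid it. Write \<open>S\<^sub>1\<close>, \<open>S\<^sub>2\<close> for the subset sums of these powers of
  \<open>D\<^sub>1\<close>, \<open>D\<^sub>2\<close>, and \<open>S\<close> for those of \<open>C\<close>. Because distinct bases never share a power, numbers
  from \<open>S\<^sub>1\<close>, \<open>S\<^sub>2\<close> and \<open>S\<close> can be added freely, and every sum is again a subset sum.

  The hypothesis on \<open>\<Sum> 1 / (d - 1)\<close> makes the powers of each \<open>D\<^sub>i\<close> below \<open>t\<close> add up to at least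
  \<open>t - K\<close> for a constant \<open>K\<close>; the greedy algorithm then shows that \<open>S\<^sub>i\<close> has bounded gaps
  (\<open>powers_bounded_gaps\<close>). Once \<open>S\<^sub>2 + S\<close> contains an interval longer than the gaps of \<open>S\<^sub>1\<close>, the
  translates of that interval by \<open>S\<^sub>1\<close> cover all large integers. So it remains to find arbitrarily
  long intervals in \<open>S\<^sub>2 + S\<close>.

  The bounded gaps of \<open>S\<^sub>2\<close> give it positive density, which sets up a density increment
  argument. Among all sets \<open>S\<^sub>2 +\<close> (subset sums of \<open>A\<close>), with \<open>A\<close> a finite set of powers of \<open>C\<close>, take one set \<open>E\<close> whose upper density is within \<open>\<epsilon>\<close> of the supremum
  (\<open>density_saturation\<close>). Enlarging \<open>A\<close> cannot raise the density by more than \<open>\<epsilon>\<close>, so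
  translating \<open>E\<close> by any subset sum \<open>t\<close> of the other powers of \<open>C\<close> maps \<open>E\<close> into itself
  up to density \<open>\<epsilon>\<close>. The bound is the same however many terms \<open>t\<close> has, and this uniformity is what the
  argument rests on. Any integer \<open>a * c ^ n\<close> is a sum of only \<open>c - 1\<close> subset sums of
  \<open>c ^ n, c ^ (n + 1), \<dots>\<close>: write \<open>a\<close> in base \<open>c\<close> and split its digits into zeros and ones. As
  \<open>Gcd C = 1\<close>, every large integer is a nonnegative combination of the \<open>c ^ n\<close>, hence a sum of
  at most \<open>\<Sum> (c - 1)\<close> such subset sums, a number independent of \<open>n\<close> and so of \<open>A\<close>
  (\<open>large_integers_as_few_power_sums\<close>). Therefore \<open>E\<close> is nearly invariant under every large
  translation, with an error fixed in advance. Applying this to \<open>K\<close> consecutive translations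
  \<open>w, w + 1, \<dots>\<close> yields a \<open>z \<in> E\<close> with \<open>z + w + j \<in> E\<close> for all \<open>j < K\<close>, which is the desired
  interval (\<open>long_interval_in_sumset\<close>).
\<close>

section \<open>Subset sums\<close>

definition subset_sums :: "nat set \<Rightarrow> nat set" where
  "subset_sums A = {\<Sum>S | S. finite S \<and> S \<subseteq> A}"

lemma zero_in_subset_sums [simp]: "0 \<in> subset_sums A"
  unfolding subset_sums_def by (auto intro!: exI[of _ "{}"])

lemma subset_sums_mono: "A \<subseteq> B \<Longrightarrow> subset_sums A \<subseteq> subset_sums B"
  unfolding subset_sums_def by blast

lemma subset_sums_add:
  assumes "s \<in> subset_sums A" "t \<in> subset_sums B" "A \<inter> B = {}"
  shows "s + t \<in> subset_sums (A \<union> B)"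
proof -
  obtain S where S: "finite S" "S \<subseteq> A" "s = \<Sum>S" using assms(1) by (auto simp: subset_sums_def)
  obtain T where T: "finite T" "T \<subseteq> B" "t = \<Sum>T" using assms(2) by (auto simp: subset_sums_def)
  have "s + t = \<Sum>(S \<union> T)"
    using S T assms(3) by (auto intro!: sum.union_disjoint[symmetric])
  thus ?thesis using S T unfolding subset_sums_def by blast
qed

text \<open>
  The greedy algorithm as an induction on the largest admissible summand. A target \<open>x\<close> that is out
  of reach without \<open>t\<close> exceeds \<open>\<Sum>(A \<inter> {..<t}) + K \<ge> t\<close>, so \<open>t\<close> can be subtracted from it.
\<close>

lemma subset_sums_bounded_gaps_below:
  assumes "\<And>t. t \<le> \<Sum>(A \<inter> {..<t}) + K" and "x \<le> \<Sum>(A \<inter> {..<t}) + K"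
  shows "\<exists>s\<in>subset_sums (A \<inter> {..<t}). s \<le> x \<and> x \<le> s + K"
  using assms(2)
proof (induction t arbitrary: x)
  case 0
  thus ?case by (intro bexI[of _ 0]) auto
next
  case (Suc t)
  show ?case
  proof (cases "x \<le> \<Sum>(A \<inter> {..<t}) + K")
    case True
    then obtain s where "s \<in> subset_sums (A \<inter> {..<t})" "s \<le> x" "x \<le> s + K"
      using Suc.IH by blast
    moreover have "A \<inter> {..<t} \<subseteq> A \<inter> {..<Suc t}" by auto
    ultimately show ?thesis using subset_sums_mono by blast
  next
    case False
    hence "t \<in> A"
      using Suc.prems by (cases "t \<in> A") (auto simp: lessThan_Suc)
    hence eq: "A \<inter> {..<Suc t} = (A \<inter> {..<t}) \<union> {t}" by (auto simp: lessThan_Suc)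
    have "t \<le> x" using False assms(1)[of t] by linarith
    have "x - t \<le> \<Sum>(A \<inter> {..<t}) + K"
      using Suc.prems unfolding eq by (subst (asm) sum.union_disjoint) auto
    then obtain s where s: "s \<in> subset_sums (A \<inter> {..<t})" "s \<le> x - t" "x - t \<le> s + K"
      using Suc.IH by blast
    have "t \<in> subset_sums {t}"
      unfolding subset_sums_def by (auto intro!: exI[of _ "{t}"])
    hence "s + t \<in> subset_sums (A \<inter> {..<Suc t})"
      unfolding eq by (intro subset_sums_add s) auto
    thus ?thesis using s \<open>t \<le> x\<close> by (intro bexI[of _ "s + t"]) auto
  qed
qed

lemma subset_sums_bounded_gaps:
  assumes "\<And>t. t \<le> \<Sum>(A \<inter> {..<t}) + K"
  shows "\<exists>s\<in>subset_sums A. s \<le> x \<and> x \<le> s + K"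
proof -
  obtain s where "s \<in> subset_sums (A \<inter> {..<x})" "s \<le> x" "x \<le> s + K"
    using subset_sums_bounded_gaps_below[OF assms assms] by blast
  thus ?thesis using subset_sums_mono[of "A \<inter> {..<x}" A] by auto
qed

section \<open>Translates of a set of nearly maximal density\<close>

text \<open>
  The upper density of \<open>E = X +\<close> (subset sums of \<open>A\<close>) is at least \<open>q\<close>, and \<open>q\<close> is within \<open>\<epsilon>\<close>
  of the supremum of these densities over all finite \<open>A \<subseteq> V\<close>. Adjoining to \<open>A\<close> the finitely many summands of \<open>t\<close> gives a
  competitor that contains both \<open>E\<close> and its translate by \<open>t\<close>, so the two overlap almost entirely.
  The upper density of \<open>E\<close> is attained along some sequence of \<open>N\<close> only, whereas the upper bounds for
  the competitors hold for all large \<open>N\<close>; this is why finitely many \<open>t\<close> can be treated at a common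
  \<open>N\<close>.
\<close>

lemma density_saturation:
  fixes X V :: "nat set" and \<epsilon> :: real
  assumes "\<epsilon> > 0"
  obtains A q where "finite A" "A \<subseteq> V"
    "\<exists>\<^sub>F N in sequentially. q * real N \<le> real (card ((X + subset_sums A) \<inter> {..<N}))"
    "\<And>t. t \<in> subset_sums (V - A) \<Longrightarrow>
       \<forall>\<^sub>F N in sequentially. real (card ((X + subset_sums A + {0, t}) \<inter> {..<N})) < (q + \<epsilon>) * real N"
proof -
  define dense where "dense q A \<longleftrightarrow>
    (\<exists>\<^sub>F N in sequentially. q * real N \<le> real (card ((X + subset_sums A) \<inter> {..<N})))" for q A
  define Q where "Q = {q. \<exists>A. finite A \<and> A \<subseteq> V \<and> dense q A}"
  have "0 \<in> Q" unfolding Q_def dense_def by (auto intro!: exI[of _ "{}"])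
  have "q \<le> 1" if "q \<in> Q" for q
  proof -
    obtain A where "dense q A" using \<open>q \<in> Q\<close> unfolding Q_def by blast
    hence "\<exists>\<^sub>F N in sequentially. 0 < N \<and> q * real N \<le> real (card ((X + subset_sums A) \<inter> {..<N}))"
      unfolding dense_def
      by (rule frequently_eventually_frequently[THEN frequently_elim1])
        (auto intro: eventually_gt_at_top[of 0])
    then obtain N where N: "0 < N" "q * real N \<le> real (card ((X + subset_sums A) \<inter> {..<N}))"
      using frequently_ex by blast
    have "card ((X + subset_sums A) \<inter> {..<N}) \<le> card {..<N}" by (intro card_mono) auto
    hence "q * real N \<le> 1 * real N" using N(2) by simp
    thus ?thesis using N(1) by simp
  qed
  hence bdd: "bdd_above Q" by (auto simp: bdd_above_def)
  obtain q where q: "q \<in> Q" "Sup Q - \<epsilon> < q"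
    using less_cSupD[of Q "Sup Q - \<epsilon>"] assms \<open>0 \<in> Q\<close> by auto
  then obtain A where A: "finite A" "A \<subseteq> V" "dense q A" unfolding Q_def by blast
  show ?thesis
  proof (rule that[OF A(1,2) A(3)[unfolded dense_def]])
    fix t assume "t \<in> subset_sums (V - A)"
    then obtain T where T: "finite T" "T \<subseteq> V - A" "t = \<Sum>T" by (auto simp: subset_sums_def)
    have "q + \<epsilon> \<notin> Q" using cSup_upper[OF _ bdd, of "q + \<epsilon>"] q by auto
    hence "\<not> dense (q + \<epsilon>) (A \<union> T)" using A T unfolding Q_def by blast
    hence ev: "\<forall>\<^sub>F N in sequentially.
        real (card ((X + subset_sums (A \<union> T)) \<inter> {..<N})) < (q + \<epsilon>) * real N"
      unfolding dense_def not_frequently by (simp add: not_le)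
    have "t \<in> subset_sums T" using T by (auto simp: subset_sums_def)
    have "subset_sums A + {0, t} \<subseteq> subset_sums (A \<union> T)"
    proof
      fix y assume "y \<in> subset_sums A + {0, t}"
      then obtain a b where ab: "y = a + b" "a \<in> subset_sums A" "b \<in> {0, t}"
        by (rule set_plus_elim)
      have "b \<in> subset_sums T" using ab(3) \<open>t \<in> subset_sums T\<close> by auto
      thus "y \<in> subset_sums (A \<union> T)"
        unfolding ab(1) using T(2) by (intro subset_sums_add ab(2)) auto
    qed
    hence "X + subset_sums A + {0, t} \<subseteq> X + subset_sums (A \<union> T)"
      by (metis add.assoc set_plus_mono2 order_refl)
    hence "card ((X + subset_sums A + {0, t}) \<inter> {..<N}) \<le> card ((X + subset_sums (A \<union> T)) \<inter> {..<N})" for N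
      by (intro card_mono) auto
    with ev show "\<forall>\<^sub>F N in sequentially.
        real (card ((X + subset_sums A + {0, t}) \<inter> {..<N})) < (q + \<epsilon>) * real N"
      by (elim eventually_mono) (meson le_less_trans of_nat_le_iff)
  qed
qed

text \<open>
  Only the starting point \<open>x\<close> is cut off at \<open>N\<close>: a point \<open>x + t\<close> beyond \<open>N\<close> is still tested against
  \<open>E\<close>, so that an empty defect means \<open>x + t \<in> E\<close> for every \<open>x \<in> E\<close> below \<open>N\<close>.
\<close>

definition shift_defect :: "nat set \<Rightarrow> nat \<Rightarrow> nat \<Rightarrow> nat set" where
  "shift_defect E N t = {x \<in> E. x < N \<and> x + t \<notin> E}"

lemma finite_shift_defect [simp]: "finite (shift_defect E N t)"
  unfolding shift_defect_def by (rule finite_subset[of _ "{..<N}"]) auto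

text \<open>
  The translates \<open>x + t\<close> of defect points are new points of \<open>E \<union> (E + t)\<close> outside \<open>E\<close>; at most \<open>t\<close>
  of them fall into \<open>{N..<N + t}\<close> and are not counted below \<open>N\<close>.
\<close>

lemma card_shift_defect_le:
  "card (shift_defect E N t) + card (E \<inter> {..<N}) \<le> card ((E + {0, t}) \<inter> {..<N}) + t"
proof -
  have "(\<lambda>x. x + t) ` shift_defect E N t \<inter> (E \<inter> {..<N}) = {}"
    by (auto simp: shift_defect_def)
  moreover have "finite ((\<lambda>x. x + t) ` shift_defect E N t)" by simp
  ultimately have "card ((\<lambda>x. x + t) ` shift_defect E N t \<union> (E \<inter> {..<N})) =
      card (shift_defect E N t) + card (E \<inter> {..<N})"
    by (subst card_Un_disjoint) (auto intro!: card_image inj_onI)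
  moreover have "(\<lambda>x. x + t) ` shift_defect E N t \<union> (E \<inter> {..<N}) \<subseteq>
      (E + {0, t}) \<inter> {..<N} \<union> {N..<N + t}"
  proof -
    have "x + t \<in> E + {0, t}" "x \<in> E + {0, t}" if "x \<in> E" for x
      using that set_plus_intro[of x E t "{0, t}"] set_plus_intro[of x E 0 "{0, t}"] by auto
    thus ?thesis by (auto simp: shift_defect_def)
  qed
  hence "card ((\<lambda>x. x + t) ` shift_defect E N t \<union> (E \<inter> {..<N})) \<le>
      card ((E + {0, t}) \<inter> {..<N} \<union> {N..<N + t})"
    by (intro card_mono) auto
  moreover have "card ((E + {0, t}) \<inter> {..<N} \<union> {N..<N + t}) \<le> card ((E + {0, t}) \<inter> {..<N}) + t"
    using card_Un_le[of "(E + {0, t}) \<inter> {..<N}" "{N..<N + t}"] by simp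
  ultimately show ?thesis by linarith
qed

lemma card_shift_defect_add:
  "card (shift_defect E N (s + t)) \<le>
     card (shift_defect E N s) + s + card (shift_defect E N t)"
proof -
  have "card (shift_defect E N (s + t) - shift_defect E N s) =
      card ((\<lambda>x. x + s) ` (shift_defect E N (s + t) - shift_defect E N s))"
    by (intro card_image[symmetric] inj_onI) auto
  also have "\<dots> \<le> card (shift_defect E N t \<union> {N..<N + s})"
    by (intro card_mono) (auto simp: shift_defect_def add_ac)
  also have "\<dots> \<le> card (shift_defect E N t) + s"
    using card_Un_le[of "shift_defect E N t" "{N..<N + s}"] by simp
  finally show ?thesis
    using diff_card_le_card_Diff[of "shift_defect E N s" "shift_defect E N (s + t)"] by simp
qed

lemma card_shift_defect_sum:
  assumes "finite I"
  shows "card (shift_defect E N (\<Sum>i\<in>I. t i)) \<le> (\<Sum>i\<in>I. t i + card (shift_defect E N (t i)))"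
  using assms
proof (induction I rule: finite_induct)
  case empty
  have "shift_defect E N 0 = {}" by (auto simp: shift_defect_def)
  thus ?case by simp
next
  case (insert i I)
  thus ?case using card_shift_defect_add[of E N "t i" "\<Sum>i\<in>I. t i"] by simp
qed

text \<open>
  The representations of large integers must use the same number \<open>card I\<close> of subset sums whatever
  finite \<open>F\<close> is excluded: the admissible loss \<open>\<epsilon>\<close> per translation is fixed from \<open>card I\<close> first, and
  only then does saturation produce the finite set to be avoided.
\<close>

lemma long_interval_in_sumset:
  fixes X V :: "nat set" and \<delta> :: real and I :: "'i set" and K :: nat
  assumes "\<delta> > 0"
    and dense: "\<forall>\<^sub>F N in sequentially. \<delta> * real N \<le> real (card (X \<inter> {..<N}))"
    and "finite I"
    and repr: "\<And>F. finite F \<Longrightarrow> F \<subseteq> V \<Longrightarrow>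
      \<forall>\<^sub>F w in sequentially. \<exists>t. (\<forall>i\<in>I. t i \<in> subset_sums (V - F)) \<and> w = (\<Sum>i\<in>I. t i)"
  shows "\<exists>x. {x..<x + K} \<subseteq> X + subset_sums V"
proof -
  \<comment> \<open>\<open>K * card I\<close> translations lose at most half of the density \<open>\<delta>\<close>; the summand 1 only avoids
    a division by zero.\<close>
  define \<epsilon> where "\<epsilon> = \<delta> / (2 * (real K * real (card I) + 1))"
  have "\<epsilon> > 0" unfolding \<epsilon>_def using \<open>\<delta> > 0\<close> by (intro divide_pos_pos) (auto intro: add_nonneg_pos)
  obtain A q where A: "finite A" "A \<subseteq> V"
    and freq: "\<exists>\<^sub>F N in sequentially. q * real N \<le> real (card ((X + subset_sums A) \<inter> {..<N}))"
    and sat: "\<And>t. t \<in> subset_sums (V - A) \<Longrightarrow>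
       \<forall>\<^sub>F N in sequentially. real (card ((X + subset_sums A + {0, t}) \<inter> {..<N})) < (q + \<epsilon>) * real N"
    using density_saturation[OF \<open>\<epsilon> > 0\<close>, of V X] by blast
  define E where "E = X + subset_sums A"
  have "X \<subseteq> E" unfolding E_def using set_plus_intro[of _ X 0 "subset_sums A"] by force
  obtain w where w: "\<And>u. u \<ge> w \<Longrightarrow>
      \<exists>t. (\<forall>i\<in>I. t i \<in> subset_sums (V - A)) \<and> u = (\<Sum>i\<in>I. t i)"
    using repr[OF A] unfolding eventually_sequentially by blast
  \<comment> \<open>Starting from the large number \<open>w\<close> makes all translations nonnegative sums, so that no
    translation to the left is needed.\<close>
  have "\<forall>j. \<exists>t. (\<forall>i\<in>I. t i \<in> subset_sums (V - A)) \<and> w + j = (\<Sum>i\<in>I. t i)"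
    using w by simp
  then obtain t where t: "\<And>i j. i \<in> I \<Longrightarrow> t j i \<in> subset_sums (V - A)"
    "\<And>j. w + j = (\<Sum>i\<in>I. t j i)" by metis
  define c where "c = (\<Sum>j<K. \<Sum>i\<in>I. 2 * t j i)"
  have "filterlim (\<lambda>N. (\<delta> / 2) * real N) at_top sequentially"
    using \<open>\<delta> > 0\<close>
    by (intro filterlim_tendsto_pos_mult_at_top[OF tendsto_const] filterlim_real_sequentially) auto
  hence "\<forall>\<^sub>F N in sequentially. real c < (\<delta> / 2) * real N"
    unfolding filterlim_at_top_dense by blast
  moreover have "\<forall>\<^sub>F N in sequentially. \<forall>j\<in>{..<K}. \<forall>i\<in>I.
      real (card ((E + {0, t j i}) \<inter> {..<N})) < (q + \<epsilon>) * real N"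
    using sat[OF t(1)] \<open>finite I\<close> unfolding E_def by (intro eventually_ball_finite ballI) auto
  ultimately have "\<forall>\<^sub>F N in sequentially. real c < (\<delta> / 2) * real N \<and>
      \<delta> * real N \<le> real (card (X \<inter> {..<N})) \<and>
      (\<forall>j\<in>{..<K}. \<forall>i\<in>I. real (card ((E + {0, t j i}) \<inter> {..<N})) < (q + \<epsilon>) * real N)"
    using dense by eventually_elim auto
  with freq obtain N where N: "q * real N \<le> real (card (E \<inter> {..<N}))" "real c < (\<delta> / 2) * real N"
      "\<delta> * real N \<le> real (card (X \<inter> {..<N}))"
      "\<And>i j. j < K \<Longrightarrow> i \<in> I \<Longrightarrow> real (card ((E + {0, t j i}) \<inter> {..<N})) < (q + \<epsilon>) * real N"
    unfolding E_def[symmetric]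
    using frequently_ex[OF frequently_eventually_frequently] by (smt (verit) lessThan_iff)
  have small: "real (card (shift_defect E N (t j i))) \<le> real (t j i) + \<epsilon> * real N"
    if "j < K" "i \<in> I" for i j
  proof -
    have "real (card (shift_defect E N (t j i))) + real (card (E \<inter> {..<N})) \<le>
        real (card ((E + {0, t j i}) \<inter> {..<N})) + real (t j i)"
      using card_shift_defect_le[of E N "t j i"] by (simp only: flip: of_nat_add of_nat_le_iff)
    moreover have "(q + \<epsilon>) * real N = q * real N + \<epsilon> * real N" by (simp add: algebra_simps)
    ultimately show ?thesis using N(1) N(4)[OF that] by linarith
  qed
  have "real (card (\<Union>j<K. shift_defect E N (w + j))) \<le> real (\<Sum>j<K. card (shift_defect E N (w + j)))"
    using card_UN_le[of "{..<K}"] by (simp only: of_nat_le_iff) simp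
  also have "\<dots> \<le> real (\<Sum>j<K. \<Sum>i\<in>I. t j i + card (shift_defect E N (t j i)))"
    unfolding t(2) of_nat_le_iff by (intro sum_mono card_shift_defect_sum \<open>finite I\<close>)
  also have "\<dots> \<le> (\<Sum>j<K. \<Sum>i\<in>I. real (2 * t j i) + \<epsilon> * real N)"
    unfolding of_nat_sum of_nat_add using small by (intro sum_mono) fastforce
  also have "\<dots> = real c + real K * real (card I) * \<epsilon> * real N"
    unfolding c_def by (simp add: sum.distrib algebra_simps)
  also have "\<dots> \<le> real c + (\<delta> / 2) * real N"
  proof -
    have "real K * real (card I) * \<epsilon> \<le> (real K * real (card I) + 1) * \<epsilon>"
      using \<open>\<epsilon> > 0\<close> by (intro mult_right_mono) auto
    also have "\<dots> = \<delta> / 2"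
    proof -
      have "real K * real (card I) + 1 > 0" by (intro add_nonneg_pos) auto
      thus ?thesis unfolding \<epsilon>_def by (simp add: field_simps)
    qed
    finally show ?thesis by (intro add_left_mono mult_right_mono) auto
  qed
  also have "\<dots> < \<delta> * real N" using N(2) by linarith
  also have "\<dots> \<le> real (card (E \<inter> {..<N}))"
  proof -
    have "card (X \<inter> {..<N}) \<le> card (E \<inter> {..<N})"
      using \<open>X \<subseteq> E\<close> by (intro card_mono) auto
    thus ?thesis using N(3) by linarith
  qed
  finally have "card (\<Union>j<K. shift_defect E N (w + j)) < card (E \<inter> {..<N})" by simp
  hence "\<not> E \<inter> {..<N} \<subseteq> (\<Union>j<K. shift_defect E N (w + j))"
    using card_mono[of "\<Union>j<K. shift_defect E N (w + j)" "E \<inter> {..<N}"] by auto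
  then obtain z where z: "z \<in> E" "z < N" "\<And>j. j < K \<Longrightarrow> z \<notin> shift_defect E N (w + j)" by auto
  hence "z + (w + j) \<in> E" if "j < K" for j using that by (auto simp: shift_defect_def)
  hence "{z + w..<z + w + K} \<subseteq> E"
    by (smt (verit, ccfv_SIG) add.assoc add_less_cancel_left atLeastLessThan_iff le_Suc_ex subsetI)
  also have "E \<subseteq> X + subset_sums V"
    unfolding E_def using subset_sums_mono[OF A(2)] by (intro set_plus_mono2) auto
  finally show ?thesis by blast
qed

section \<open>Representing large integers by powers\<close>

text \<open>
  The Frobenius coin problem. When \<open>a\<close> joins \<open>G\<close>, fewer than \<open>Gcd G\<close> copies of \<open>a\<close> suffice to make
  the remainder divisible by \<open>Gcd G\<close>, so only a bounded amount is used up. The case \<open>Gcd G = 0\<close>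
  covers the empty set, from which the induction starts.
\<close>

lemma nonneg_combination_of_large_multiples:
  fixes G :: "nat set"
  assumes "finite G"
  shows "\<exists>m. \<forall>w\<ge>m. Gcd G dvd w \<longrightarrow> (\<exists>f. w = (\<Sum>g\<in>G. f g * g))"
  using assms
proof (induction G rule: finite_induct)
  case empty
  show ?case by simp
next
  case (insert a G)
  define g where "g = Gcd G"
  obtain m where m: "\<And>w. w \<ge> m \<Longrightarrow> g dvd w \<Longrightarrow> \<exists>f. w = (\<Sum>g\<in>G. f g * g)"
    using insert.IH unfolding g_def by blast
  have "\<exists>f. w = (\<Sum>g\<in>insert a G. f g * g)" if w: "w \<ge> m + g * a" "gcd a g dvd w" for w
  proof -
    have extend: ?thesis if "w = x * a + v" "v = (\<Sum>g\<in>G. f g * g)" for x v f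
    proof -
      have "(\<Sum>g\<in>G. (f(a := x)) g * g) = (\<Sum>g\<in>G. f g * g)"
        using insert.hyps by (intro sum.cong) auto
      hence "w = (\<Sum>g\<in>insert a G. (f(a := x)) g * g)"
        using that insert.hyps by simp
      thus ?thesis by blast
    qed
    show ?thesis
    proof (cases "g = 0")
      case True
      then obtain x where "w = x * a + 0" using w(2) by (auto simp: dvd_def mult.commute)
      moreover have "0 = (\<Sum>g\<in>G. 0 * g)" by simp
      ultimately show ?thesis using extend[of _ 0 "\<lambda>_. 0"] by blast
    next
      case False
      obtain x where x: "[a * x = gcd a g] (mod g)" using cong_solve_nat by blast
      obtain r where r: "w = gcd a g * r" using w(2) by blast
      define y where "y = (x * r) mod g"
      have "[y * a = x * r * a] (mod g)" unfolding y_def cong_def by (rule mod_mult_left_eq)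
      also have "x * r * a = a * x * r" by simp
      also have "[a * x * r = w] (mod g)" unfolding r using x by (rule cong_scalar_right)
      finally have cong: "[y * a = w] (mod g)" .
      have "y * a \<le> g * a" unfolding y_def using False by (intro mult_right_mono) (simp_all add: less_imp_le)
      hence le: "m \<le> w - y * a" "y * a \<le> w" using w(1) by linarith+
      have "g dvd w - y * a" using cong le(2) by (simp add: cong_altdef_nat cong_sym_eq)
      then obtain f where "w - y * a = (\<Sum>g\<in>G. f g * g)" using m le(1) by blast
      moreover have "w = y * a + (w - y * a)" using le(2) by simp
      ultimately show ?thesis using extend by blast
    qed
  qed
  thus ?case unfolding g_def by (auto intro!: exI[of _ "m + Gcd G * a"])
qed

definition powers_from :: "nat \<Rightarrow> nat set \<Rightarrow> nat set" where
  "powers_from k D = {d ^ n | d n. d \<in> D \<and> k \<le> n}"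

text \<open>
  In base \<open>c\<close>, the term \<open>t i\<close> collects the powers \<open>c ^ (n + e)\<close> for which the digit of \<open>a\<close> at
  position \<open>e\<close> exceeds \<open>i\<close>. The number of terms does not depend on \<open>a\<close> or \<open>n\<close>.
\<close>

lemma multiple_of_power_as_few_subset_sums:
  assumes "2 \<le> c"
  shows "\<exists>t. (\<forall>i<c - 1. t i \<in> subset_sums (powers_from n {c})) \<and> a * c ^ n = (\<Sum>i<c - 1. t i)"
proof (induction a arbitrary: n rule: less_induct)
  case (less a)
  show ?case
  proof (cases "a = 0")
    case True
    thus ?thesis by (intro exI[of _ "\<lambda>_. 0"]) auto
  next
    case False
    hence "a div c < a" using assms by simp
    then obtain t where t: "\<And>i. i < c - 1 \<Longrightarrow> t i \<in> subset_sums (powers_from (Suc n) {c})"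
      "a div c * c ^ Suc n = (\<Sum>i<c - 1. t i)" using less.IH by blast
    define d where "d = a mod c"
    have "d \<le> c - 1" unfolding d_def using assms
      by (metis Suc_diff_1 less_Suc_eq_le mod_less_divisor pos2 order_less_le_trans)
    define u where "u i = (if i < d then c ^ n else 0) + t i" for i
    have "(\<Sum>i<c - 1. u i) = (\<Sum>i<c - 1. if i < d then c ^ n else 0) + a div c * c ^ Suc n"
      unfolding u_def t(2) by (rule sum.distrib)
    also have "(\<Sum>i<c - 1. if i < d then c ^ n else 0) = (\<Sum>i<d. c ^ n)"
      using \<open>d \<le> c - 1\<close> by (intro sum.mono_neutral_cong_right) auto
    also have "(\<Sum>i<d. c ^ n) + a div c * c ^ Suc n = (a div c * c + d) * c ^ n"
      by (simp add: algebra_simps)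
    also have "a div c * c + d = a" unfolding d_def by simp
    finally have "a * c ^ n = (\<Sum>i<c - 1. u i)" by simp
    moreover have "u i \<in> subset_sums (powers_from n {c})" if "i < c - 1" for i
    proof -
      have "(if i < d then c ^ n else 0) \<in> subset_sums {c ^ n}"
        unfolding subset_sums_def by (auto intro: exI[of _ "{}"] exI[of _ "{c ^ n}"])
      moreover have "{c ^ n} \<inter> powers_from (Suc n) {c} = {}"
      proof -
        have "c ^ n < c ^ m" if "Suc n \<le> m" for m
          using assms that by (intro power_strict_increasing) auto
        thus ?thesis unfolding powers_from_def by fastforce
      qed
      ultimately have "u i \<in> subset_sums ({c ^ n} \<union> powers_from (Suc n) {c})"
        unfolding u_def using t(1)[OF that] by (intro subset_sums_add)
      moreover have "{c ^ n} \<union> powers_from (Suc n) {c} \<subseteq> powers_from n {c}"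
        by (auto simp: powers_from_def intro: Suc_leD)
      ultimately show ?thesis using subset_sums_mono by blast
    qed
    ultimately show ?thesis by blast
  qed
qed

lemma Gcd_image_power_eq_1:
  fixes C :: "nat set"
  assumes "finite C" "Gcd C = 1"
  shows "Gcd ((\<lambda>c. c ^ n) ` C) = 1"
proof -
  have "is_unit (Gcd ((\<lambda>c. c ^ n) ` C))"
  proof (rule ccontr)
    assume "\<not> ?thesis"
    then obtain p where p: "prime p" "p dvd Gcd ((\<lambda>c. c ^ n) ` C)"
      using prime_factor_nat by (metis nat_dvd_1_iff_1)
    hence "p dvd c" if "c \<in> C" for c
      using that prime_dvd_power[of p c n] by (metis Gcd_dvd dvd_trans imageI)
    hence "p dvd Gcd C" by (rule Gcd_greatest)
    thus False using assms(2) p(1) by simp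
  qed
  thus ?thesis by simp
qed

text \<open>
  The index set depends on \<open>C\<close> alone: excluding a larger \<open>F\<close> only raises the exponent \<open>n\<close> from which
  the powers are taken, and the powers \<open>c ^ n\<close> still have greatest common divisor 1.
\<close>

lemma large_integers_as_few_power_sums:
  assumes "finite C" "C \<subseteq> {2..}" "Gcd C = 1" "finite F"
  shows "\<forall>\<^sub>F w in sequentially. \<exists>t.
     (\<forall>i\<in>Sigma C (\<lambda>c. {..<c - 1}). t i \<in> subset_sums (powers_from k C - F)) \<and>
     w = (\<Sum>i\<in>Sigma C (\<lambda>c. {..<c - 1}). t i)"
proof -
  define n where "n = max (max k 1) (Suc (\<Sum>F))"
  have inj: "inj_on (\<lambda>c. c ^ n) C"
  proof (rule inj_onI)
    fix a b :: nat assume "a ^ n = b ^ n"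
    moreover have "n > 0" unfolding n_def by simp
    ultimately show "a = b" by (simp add: power_eq_iff_eq_base)
  qed
  have sub: "powers_from n {c} \<subseteq> powers_from k C - F" if "c \<in> C" for c
  proof
    fix y assume "y \<in> powers_from n {c}"
    then obtain m where m: "y = c ^ m" "n \<le> m" by (auto simp: powers_from_def)
    have "2 \<le> c" using that assms(2) by auto
    have "\<Sum>F < m" using m(2) unfolding n_def by linarith
    also have "m < 2 ^ m" by simp
    also have "2 ^ m \<le> c ^ m" using \<open>2 \<le> c\<close> by (intro power_mono) auto
    finally have "y \<notin> F"
      using member_le_sum[of y F "\<lambda>x. x"] \<open>finite F\<close> unfolding m(1) by fastforce
    moreover have "y \<in> powers_from k C"
      using m that unfolding n_def powers_from_def by auto
    ultimately show "y \<in> powers_from k C - F" by blast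
  qed
  obtain m where m: "\<And>w. w \<ge> m \<Longrightarrow> \<exists>f. w = (\<Sum>g\<in>(\<lambda>c. c ^ n) ` C. f g * g)"
    using nonneg_combination_of_large_multiples[of "(\<lambda>c. c ^ n) ` C"] assms(1)
      Gcd_image_power_eq_1[OF assms(1,3), of n] by auto
  have "\<exists>t. (\<forall>i\<in>Sigma C (\<lambda>c. {..<c - 1}). t i \<in> subset_sums (powers_from k C - F)) \<and>
     w = (\<Sum>i\<in>Sigma C (\<lambda>c. {..<c - 1}). t i)" if w: "w \<ge> m" for w
  proof -
    obtain f where f: "w = (\<Sum>g\<in>(\<lambda>c. c ^ n) ` C. f g * g)" using m[OF w] by blast
    have "\<forall>c\<in>C. \<exists>t. (\<forall>i<c - 1. t i \<in> subset_sums (powers_from n {c})) \<and>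
        f (c ^ n) * c ^ n = (\<Sum>i<c - 1. t i)"
      using multiple_of_power_as_few_subset_sums assms(2) by blast
    then obtain t where t: "\<And>c i. c \<in> C \<Longrightarrow> i < c - 1 \<Longrightarrow> t c i \<in> subset_sums (powers_from n {c})"
      "\<And>c. c \<in> C \<Longrightarrow> f (c ^ n) * c ^ n = (\<Sum>i<c - 1. t c i)" by metis
    have "w = (\<Sum>c\<in>C. \<Sum>i<c - 1. t c i)"
      unfolding f using t(2) by (simp add: sum.reindex[OF inj])
    also have "\<dots> = (\<Sum>(c, i)\<in>Sigma C (\<lambda>c. {..<c - 1}). t c i)"
      using assms(1) by (intro sum.Sigma) auto
    finally show ?thesis
      using t(1) subset_sums_mono[OF sub] by (intro exI[of _ "\<lambda>(c, i). t c i"]) fastforce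
  qed
  thus ?thesis unfolding eventually_sequentially by blast
qed

section \<open>Powers of multiplicatively independent bases\<close>

text \<open>
  After cancelling the common factor of the exponents, \<open>a ^ m' = b ^ n'\<close> with \<open>m'\<close>, \<open>n'\<close> coprime
  forces \<open>n'\<close> to divide every prime multiplicity of \<open>a\<close>, so \<open>a = c ^ n'\<close> and then \<open>b = c ^ m'\<close>.
\<close>

lemma common_power_imp_powers_of_same_integer:
  fixes a b :: nat
  assumes "a ^ m = b ^ n" "m > 0" "n > 0"
  shows "powers_of_same_integer a b"
proof -
  define m' n' where "m' = m div gcd m n" and "n' = n div gcd m n"
  have mn: "m = m' * gcd m n" "n = n' * gcd m n" unfolding m'_def n'_def by simp_all
  have pos: "m' > 0" "n' > 0" "gcd m n > 0" using mn assms(2,3) by (metis mult_0 neq0_conv, metis mult_0 neq0_conv, simp)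
  have cop: "coprime n' m'"
    unfolding m'_def n'_def using assms(2) by (metis div_gcd_coprime coprime_commute neq0_conv)
  have "(a ^ m') ^ gcd m n = (b ^ n') ^ gcd m n"
    using assms(1) mn by (metis power_mult)
  hence eq: "a ^ m' = b ^ n'" using pos(3) by (metis power_eq_iff_eq_base zero_le)
  have "is_nth_power n' a"
  proof (cases "a = 0")
    case False
    have "n' dvd multiplicity p a" if "prime p" for p
    proof -
      have "b \<noteq> 0" using eq False pos by (metis power_eq_0_iff neq0_conv)
      hence "m' * multiplicity p a = n' * multiplicity p b"
        using arg_cong[OF eq, of "multiplicity p"] that False
        by (simp add: prime_elem_multiplicity_power_distrib)
      hence "n' dvd m' * multiplicity p a" by simp
      thus ?thesis using cop by (simp add: coprime_dvd_mult_right_iff)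
    qed
    thus ?thesis using pos(2) by (subst is_nth_power_conv_multiplicity_nat) auto
  qed (use pos in simp)
  then obtain c where c: "a = c ^ n'" by (elim is_nth_powerE)
  have "(c ^ m') ^ n' = b ^ n'" using eq unfolding c by (simp add: mult.commute flip: power_mult)
  hence "b = c ^ m'" using pos(2) by (metis power_eq_iff_eq_base zero_le)
  thus ?thesis unfolding powers_of_same_integer_def c by (metis of_nat_power)
qed

text \<open>
  If \<open>d ^ (k + m)\<close> is the first power that is at least \<open>t\<close>, the geometric sum of the preceding ones
  is \<open>(d ^ (k + m) - d ^ k) / (d - 1)\<close>.
\<close>

lemma sum_powers_below:
  assumes "2 \<le> d"
  shows "(real t - real (d ^ k)) / (real d - 1) \<le> real (\<Sum>(powers_from k {d} \<inter> {..<t}))"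
proof -
  have "t \<le> d ^ (k + t)"
  proof -
    have "t < 2 ^ t" by simp
    also have "\<dots> \<le> d ^ t" using assms by (intro power_mono) auto
    also have "\<dots> \<le> d ^ (k + t)" using assms by (intro power_increasing) auto
    finally show ?thesis by simp
  qed
  define m where "m = (LEAST m. t \<le> d ^ (k + m))"
  have m: "t \<le> d ^ (k + m)" unfolding m_def by (rule LeastI) fact
  have less: "d ^ (k + i) < t" if "i < m" for i
    using not_less_Least[OF that[unfolded m_def]] by simp
  have geom: "(real d - 1) * (\<Sum>i<j. real (d ^ (k + i))) = real (d ^ (k + j)) - real (d ^ k)" for j
    by (induction j) (simp_all add: algebra_simps)
  have "inj_on (\<lambda>i. d ^ (k + i)) {..<m}"
    using assms by (intro inj_onI) auto
  hence "(\<Sum>i<m. d ^ (k + i)) = \<Sum>((\<lambda>i. d ^ (k + i)) ` {..<m})"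
    by (simp add: sum.reindex)
  also have "\<dots> \<le> \<Sum>(powers_from k {d} \<inter> {..<t})"
    by (intro sum_mono2) (auto simp: powers_from_def less)
  finally have "(\<Sum>i<m. real (d ^ (k + i))) \<le> real (\<Sum>(powers_from k {d} \<inter> {..<t}))"
    by (simp only: flip: of_nat_sum of_nat_le_iff)
  moreover have "real t - real (d ^ k) \<le> (real d - 1) * (\<Sum>i<m. real (d ^ (k + i)))"
    unfolding geom using m by (simp only: diff_right_mono of_nat_le_iff)
  hence "(real t - real (d ^ k)) / (real d - 1) \<le> (\<Sum>i<m. real (d ^ (k + i)))"
    using assms by (simp add: pos_divide_le_eq mult.commute)
  ultimately show ?thesis by linarith
qed

text \<open>
  Summing the lower bounds \<open>(t - d ^ k) / (d - 1)\<close> over \<open>D\<close> gives at least \<open>t\<close> minus a constant.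
  Independence ensures that a power is not counted for two bases.
\<close>

lemma powers_bounded_gaps:
  assumes "finite D" "D \<subseteq> {2..}" "0 < k"
    and indep: "\<And>a b. a \<in> D \<Longrightarrow> b \<in> D \<Longrightarrow> a \<noteq> b \<Longrightarrow> \<not> powers_of_same_integer a b"
    and large: "(\<Sum>d\<in>D. 1 / (real d - 1)) \<ge> 1"
  shows "\<exists>K. \<forall>x. \<exists>s\<in>subset_sums (powers_from k D). s \<le> x \<and> x \<le> s + K"
proof -
  define K where "K = nat \<lceil>\<Sum>d\<in>D. real (d ^ k) / (real d - 1)\<rceil>"
  have "t \<le> \<Sum>(powers_from k D \<inter> {..<t}) + K" for t
  proof -
    have "real t * 1 \<le> real t * (\<Sum>d\<in>D. 1 / (real d - 1))"
      using large by (intro mult_left_mono) auto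
    also have "\<dots> = (\<Sum>d\<in>D. (real t - real (d ^ k)) / (real d - 1)) + (\<Sum>d\<in>D. real (d ^ k) / (real d - 1))"
      by (simp add: sum_distrib_left diff_divide_distrib flip: sum.distrib)
    also have "\<dots> \<le> (\<Sum>d\<in>D. real (\<Sum>(powers_from k {d} \<inter> {..<t}))) + real K"
      using assms(2) unfolding K_def by (intro add_mono sum_mono sum_powers_below real_nat_ceiling_ge) auto
    also have "(\<Sum>d\<in>D. real (\<Sum>(powers_from k {d} \<inter> {..<t}))) =
        real (\<Sum>(\<Union>d\<in>D. powers_from k {d} \<inter> {..<t}))"
      unfolding of_nat_sum[symmetric] of_nat_eq_iff
    proof (rule sum.UNION_disjoint[symmetric, OF assms(1)])
      have "a ^ m \<noteq> b ^ n" if "a \<in> D" "b \<in> D" "a \<noteq> b" "k \<le> m" "k \<le> n" for a b m n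
        using indep[OF that(1-3)] common_power_imp_powers_of_same_integer[of a m b n] that \<open>0 < k\<close>
        by auto
      thus "\<forall>a\<in>D. \<forall>b\<in>D. a \<noteq> b \<longrightarrow>
          powers_from k {a} \<inter> {..<t} \<inter> (powers_from k {b} \<inter> {..<t}) = {}"
        unfolding powers_from_def by blast
    qed auto
    also have "(\<Union>d\<in>D. powers_from k {d} \<inter> {..<t}) = powers_from k D \<inter> {..<t}"
      by (auto simp: powers_from_def)
    finally show ?thesis by (simp only: mult_1_right flip: of_nat_add of_nat_le_iff[where 'a = real])
  qed
  thus ?thesis using subset_sums_bounded_gaps by blast
qed

lemma bounded_gaps_imp_positive_density:
  fixes X :: "nat set"
  assumes "\<And>x. \<exists>s\<in>X. s \<le> x \<and> x \<le> s + K"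
  shows "\<forall>\<^sub>F N in sequentially. 1 / (real K + 1) * real N \<le> real (card (X \<inter> {..<N}))"
proof -
  obtain f where f: "\<And>x. f x \<in> X" "\<And>x. f x \<le> x" "\<And>x. x \<le> f x + K" using assms by metis
  have "N \<le> (K + 1) * card (X \<inter> {..<N})" for N
  proof -
    have "{..<N} \<subseteq> (\<Union>s\<in>X \<inter> {..<N}. {s..s + K})"
    proof
      fix y assume "y \<in> {..<N}"
      thus "y \<in> (\<Union>s\<in>X \<inter> {..<N}. {s..s + K})"
        using f[of y] by (intro UN_I[of "f y"]) auto
    qed
    hence "card {..<N} \<le> card (\<Union>s\<in>X \<inter> {..<N}. {s..s + K})"
      by (intro card_mono) auto
    also have "\<dots> \<le> (\<Sum>s\<in>X \<inter> {..<N}. card {s..s + K})"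
      by (intro card_UN_le) auto
    finally show ?thesis by (simp add: mult.commute)
  qed
  hence "real N \<le> (real K + 1) * real (card (X \<inter> {..<N}))" for N
    by (metis of_nat_1 of_nat_add of_nat_le_iff of_nat_mult)
  hence "1 / (real K + 1) * real N \<le> real (card (X \<inter> {..<N}))" for N
    by (simp add: pos_divide_le_eq mult.commute add_nonneg_pos)
  thus ?thesis by simp
qed

section \<open>Strong completeness\<close>

theorem theorem1p5:
  fixes D D\<^sub>1 D\<^sub>2 C :: "nat set"
  assumes "finite D" and "D \<noteq> {}" and "D \<subseteq> {2..}"
    and "\<And>a b. a \<in> D \<Longrightarrow> b \<in> D \<Longrightarrow> a \<noteq> b \<Longrightarrow> \<not> powers_of_same_integer a b"
    and "D = D\<^sub>1 \<union> D\<^sub>2 \<union> C"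
    and "D\<^sub>1 \<inter> D\<^sub>2 = {}" and "D\<^sub>1 \<inter> C = {}" and "D\<^sub>2 \<inter> C = {}"
    and "D\<^sub>1 \<noteq> {}" and "D\<^sub>2 \<noteq> {}" and "C \<noteq> {}"
    and "Gcd C = 1"
    and "(\<Sum>d\<in>D\<^sub>1. 1 / (real d - 1)) \<ge> 1"
    and "(\<Sum>d\<in>D\<^sub>2. 1 / (real d - 1)) \<ge> 1"
  shows "strongly_complete_set (pos_powers D)"
  unfolding strongly_complete_set_def
proof (intro allI impI, elim conjE)
  fix B assume B: "finite B" "B \<subseteq> pos_powers D"
  define k where "k = Suc (\<Sum>B)"
  have "0 < k" unfolding k_def by simp
  have avoid: "powers_from k D \<subseteq> pos_powers D - B"
  proof
    fix y assume "y \<in> powers_from k D"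
    then obtain d n where y: "y = d ^ n" "d \<in> D" "k \<le> n" by (auto simp: powers_from_def)
    have "\<Sum>B < n" using y(3) unfolding k_def by simp
    also have "n < 2 ^ n" by simp
    also have "2 ^ n \<le> y" using y(2) assms(3) unfolding y(1) by (intro power_mono) auto
    finally have "y \<notin> B" using member_le_sum[of y B "\<lambda>x. x"] B(1) by fastforce
    thus "y \<in> pos_powers D - B" using y \<open>0 < k\<close> by (force simp: pos_powers_def)
  qed
  have disjoint: "powers_from k P \<inter> powers_from k Q = {}"
    if "P \<subseteq> D" "Q \<subseteq> D" "P \<inter> Q = {}" for P Q
  proof (rule ccontr)
    assume "\<not> ?thesis"
    then obtain a b m n where *: "a \<in> P" "b \<in> Q" "a ^ m = b ^ n" "k \<le> m" "k \<le> n"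
      by (auto simp: powers_from_def)
    hence "powers_of_same_integer a b"
      using \<open>0 < k\<close> by (intro common_power_imp_powers_of_same_integer[of a m b n]) auto
    moreover have "a \<noteq> b" using * that(3) by blast
    ultimately show False using assms(4)[of a b] * that by blast
  qed
  have gaps: "\<exists>K. \<forall>x. \<exists>s\<in>subset_sums (powers_from k P). s \<le> x \<and> x \<le> s + K"
    if "P \<subseteq> D" "(\<Sum>d\<in>P. 1 / (real d - 1)) \<ge> 1" for P
    using that assms(3,4) \<open>0 < k\<close> finite_subset[OF that(1) assms(1)]
    by (intro powers_bounded_gaps) blast+
  obtain K\<^sub>1 where K\<^sub>1: "\<And>x. \<exists>s\<in>subset_sums (powers_from k D\<^sub>1). s \<le> x \<and> x \<le> s + K\<^sub>1"
    using gaps[of D\<^sub>1] assms(5,13) by blast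
  obtain K\<^sub>2 where K\<^sub>2: "\<And>x. \<exists>s\<in>subset_sums (powers_from k D\<^sub>2). s \<le> x \<and> x \<le> s + K\<^sub>2"
    using gaps[of D\<^sub>2] assms(5,14) by blast
  have "finite C" "C \<subseteq> {2..}" using assms(1,3,5) by auto
  have "\<exists>x. {x..<x + (K\<^sub>1 + 1)} \<subseteq> subset_sums (powers_from k D\<^sub>2) + subset_sums (powers_from k C)"
  proof (rule long_interval_in_sumset[OF _ bounded_gaps_imp_positive_density[OF K\<^sub>2],
        where I = "Sigma C (\<lambda>c. {..<c - 1})"])
    show "finite (Sigma C (\<lambda>c. {..<c - 1}))" using \<open>finite C\<close> by auto
  qed (use large_integers_as_few_power_sums[OF \<open>finite C\<close> \<open>C \<subseteq> {2..}\<close> assms(12)] in auto)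
  then obtain x where x: "{x..<x + (K\<^sub>1 + 1)} \<subseteq>
      subset_sums (powers_from k D\<^sub>2) + subset_sums (powers_from k C)" by blast
  have "\<exists>S. finite S \<and> S \<subseteq> pos_powers D - B \<and> n = \<Sum>S" if "n \<ge> x + K\<^sub>1" for n
  proof -
    obtain s where s: "s \<in> subset_sums (powers_from k D\<^sub>1)" "s \<le> n - x" "n - x \<le> s + K\<^sub>1"
      using K\<^sub>1 by blast
    have "n - s \<in> {x..<x + (K\<^sub>1 + 1)}" using s that by auto
    then obtain u v where uv: "u \<in> subset_sums (powers_from k D\<^sub>2)"
        "v \<in> subset_sums (powers_from k C)" "n - s = u + v"
      using x by (meson set_plus_elim subsetD)
    have "powers_from k D\<^sub>1 \<inter> powers_from k D\<^sub>2 = {}"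
        "powers_from k D\<^sub>1 \<inter> powers_from k C = {}" "powers_from k D\<^sub>2 \<inter> powers_from k C = {}"
      using assms(5-8) by (intro disjoint; blast)+
    hence "s + (u + v) \<in> subset_sums
        (powers_from k D\<^sub>1 \<union> (powers_from k D\<^sub>2 \<union> powers_from k C))"
      using s(1) uv(1,2) by (intro subset_sums_add) (simp_all add: Int_Un_distrib)
    moreover have "s + (u + v) = n" using s(2) uv(3) by linarith
    moreover have "powers_from k D\<^sub>1 \<union> (powers_from k D\<^sub>2 \<union> powers_from k C) \<subseteq> pos_powers D - B"
      using avoid assms(5) by (force simp: powers_from_def)
    ultimately have "n \<in> subset_sums (pos_powers D - B)" using subset_sums_mono by blast
    thus ?thesis by (auto simp: subset_sums_def)
  qed
  thus "complete_set (pos_powers D - B)"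
    unfolding complete_set_def eventually_sequentially by blast
qed

end
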